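(* Let $X$ be a normed space with dual space $Y$, and let a nice amenable group $\mathbb{G}$ act dually on $X$ and $Y$, with bounded orbits. Let $E\subset X$ be $\mathbb{G}$-invariant, and let $F\subset Y$ be weak* closed, convex and $\mathbb{G}$-invariant. If the optimization problem $$\text{minimize }\;H(y\,|\,E)\qquad\text{subject to }\;y\in F$$ has a solution $\hat{y}$, then the orbitope $\Pi(\hat{y})$ contains a $\mathbb{G}$-invariant solution $\bar{y}$, and $$-H(-x\,|\,\Pi(\hat{y}))\;\leq\;\langle x,\bar{y}\rangle\;\leq\;H(x\,|\,\Pi(\hat{y}))\qquad\text{for each }x\in E.$$
   Context: A topological group is nice if its topology is locally compact and Polish. A nice group, with Haar measure $|\cdot|$, is amenable if it contains a Følner sequence, i.e. a sequence of compact sets $\mathbf{A}_n\subset\mathbb{G}$ with $|\mathbf{A}_n\cap K\mathbf{A}_n|/|\mathbf{A}_n|\to1$ for all compact $K\subset\mathbb{G}$. $Y$ is the space of all continuous linear functionals $y:X\to\mathbb{R}$, and $\langle x,y\rangle:=y(x)$. An action is linear if each map $x\mapsto\phi x$ is linear, and continuous if it is jointly continuous. Given a linear continuous action of $\mathbb{G}$ on $X$, the dual action is the unique action of $\mathbb{G}$ on $Y$ satisfying $\langle\phi x,\phi y\rangle=\langle x,y\rangle$ for all $\phi\in\mathbb{G}$, $x\in X$, $y\in Y$; one then says that $\mathbb{G}$ acts dually on $X$ and $Y$. An action on a normed space has bounded orbits if $\sup_{\phi\in\mathbb{G}}\|\phi x\|<\infty$ for every element $x$ of the space; here this is understood for the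 actions on both $X$ and $Y$ ($Y$ with the dual norm). Elements are $\mathbb{G}$-invariant if fixed by all $\phi\in\mathbb{G}$, and sets $S$ are $\mathbb{G}$-invariant if $\phi S=S$ for all $\phi$. For $y\in Y$, the orbitope $\Pi(y)$ is the weak* closed convex hull of the orbit $\{\phi y\,|\,\phi\in\mathbb{G}\}$. The support function is $H(y\,|\,E):=\sup\{\langle x,y\rangle\,|\,x\in E\}$ for $E\subset X$ and $y\in Y$, and $H(x\,|\,F):=\sup\{\langle x,y\rangle\,|\,y\in F\}$ for $F\subset Y$ and $x\in X$. *)

theory Defs
  imports "HOL-Analysis.Analysis" "HOL-Algebra.Group_Action"
begin

section \<open>Nice amenable groups\<close>

definition topological_group :: "('g, 'm) monoid_scheme \<Rightarrow> 'g topology \<Rightarrow> bool" where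
  "topological_group G T \<longleftrightarrow>
     group G \<and> topspace T = carrier G \<and>
     continuous_map (prod_topology T T) T (\<lambda>(g, h). g \<otimes>\<^bsub>G\<^esub> h) \<and>
     continuous_map T T (\<lambda>g. inv\<^bsub>G\<^esub> g)"

definition polish_topology :: "'a topology \<Rightarrow> bool" where
  "polish_topology T \<longleftrightarrow> completely_metrizable_space T \<and> separable_space T"

definition nice_group :: "('g, 'm) monoid_scheme \<Rightarrow> 'g topology \<Rightarrow> bool" where
  "nice_group G T \<longleftrightarrow>
     topological_group G T \<and> locally_compact_space T \<and> polish_topology T"

text \<open>Left Haar measure on the Borel sets of the group. Regularity is not required explicitly:
  on a locally compact Polish space, every Borel measure that is finite on compact sets is
  regular.\<close>

definition haar_measure :: "('g, 'm) monoid_scheme \<Rightarrow> 'g topology \<Rightarrow> 'g measure \<Rightarrow> bool" where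
  "haar_measure G T \<mu> \<longleftrightarrow>
     space \<mu> = topspace T \<and>
     sets \<mu> = sigma_sets (topspace T) {U. openin T U} \<and>
     emeasure \<mu> (space \<mu>) \<noteq> 0 \<and>
     (\<forall>K. compactin T K \<longrightarrow> emeasure \<mu> K < \<infinity>) \<and>
     (\<forall>g \<in> carrier G. \<forall>A \<in> sets \<mu>. emeasure \<mu> (g <#\<^bsub>G\<^esub> A) = emeasure \<mu> A)"

text \<open>The set \<open>K\<close> must be nonempty: for \<open>K = {}\<close> the quotient is constantly \<open>0\<close>, so
  admitting it would leave no amenable groups. Quotients with \<open>A n\<close> of measure zero are
  \<open>0\<close>, so the limit forces \<open>A n\<close> to have positive measure eventually.\<close>

definition folner_sequence ::
    "('g, 'm) monoid_scheme \<Rightarrow> 'g topology \<Rightarrow> 'g measure \<Rightarrow> (nat \<Rightarrow> 'g set) \<Rightarrow> bool" where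
  "folner_sequence G T \<mu> A \<longleftrightarrow>
     (\<forall>n. compactin T (A n)) \<and>
     (\<forall>K. compactin T K \<and> K \<noteq> {} \<longrightarrow>
        (\<lambda>n. measure \<mu> (A n \<inter> (K <#>\<^bsub>G\<^esub> A n)) / measure \<mu> (A n)) \<longlonglongrightarrow> 1)"

text \<open>Haar measure is unique up to a positive factor, which cancels in the quotients above, so
  it does not matter which one is used.\<close>

definition nice_amenable_group :: "('g, 'm) monoid_scheme \<Rightarrow> 'g topology \<Rightarrow> bool" where
  "nice_amenable_group G T \<longleftrightarrow>
     nice_group G T \<and> (\<exists>\<mu> A. haar_measure G T \<mu> \<and> folner_sequence G T \<mu> A)"

section \<open>Dual actions\<close>

text \<open>The dual space of \<open>'x\<close> is \<open>'x \<Rightarrow>\<^sub>L real\<close> with its operator norm, and the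
  pairing of \<open>x\<close> and \<open>y\<close> is \<open>blinfun_apply y x\<close>.\<close>

definition linear_continuous_action ::
    "('g, 'm) monoid_scheme \<Rightarrow> 'g topology \<Rightarrow> ('g \<Rightarrow> 'x \<Rightarrow> 'x::real_normed_vector) \<Rightarrow> bool" where
  "linear_continuous_action G T \<phi> \<longleftrightarrow>
     group_action G UNIV \<phi> \<and> (\<forall>g \<in> carrier G. linear (\<phi> g)) \<and>
     continuous_map (prod_topology T euclidean) euclidean (\<lambda>(g, x). \<phi> g x)"

definition acts_dually ::
    "('g, 'm) monoid_scheme \<Rightarrow> 'g topology \<Rightarrow> ('g \<Rightarrow> 'x \<Rightarrow> 'x::real_normed_vector) \<Rightarrow>
     ('g \<Rightarrow> ('x \<Rightarrow>\<^sub>L real) \<Rightarrow> ('x \<Rightarrow>\<^sub>L real)) \<Rightarrow> bool" where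
  "acts_dually G T \<phi> \<psi> \<longleftrightarrow>
     linear_continuous_action G T \<phi> \<and> group_action G UNIV \<psi> \<and>
     (\<forall>g \<in> carrier G. \<forall>x y. blinfun_apply (\<psi> g y) (\<phi> g x) = blinfun_apply y x)"

definition bounded_orbits ::
    "('g, 'm) monoid_scheme \<Rightarrow> ('g \<Rightarrow> 'v \<Rightarrow> 'v::real_normed_vector) \<Rightarrow> bool" where
  "bounded_orbits G \<phi> \<longleftrightarrow> (\<forall>v. bounded (orbit G \<phi> v))"

definition invariant_element :: "('g, 'm) monoid_scheme \<Rightarrow> ('g \<Rightarrow> 'v \<Rightarrow> 'v) \<Rightarrow> 'v \<Rightarrow> bool" where
  "invariant_element G \<phi> v \<longleftrightarrow> (\<forall>g \<in> carrier G. \<phi> g v = v)"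

definition invariant_set :: "('g, 'm) monoid_scheme \<Rightarrow> ('g \<Rightarrow> 'v \<Rightarrow> 'v) \<Rightarrow> 'v set \<Rightarrow> bool" where
  "invariant_set G \<phi> S \<longleftrightarrow> (\<forall>g \<in> carrier G. \<phi> g ` S = S)"

section \<open>Orbitopes and support functions\<close>

text \<open>For real-valued functionals, the strong operator topology (pointwise convergence) is the
  weak* topology.\<close>

abbreviation weak_star :: "('x::real_normed_vector \<Rightarrow>\<^sub>L real) topology" where
  "weak_star \<equiv> strong_operator_topology"

definition orbitope ::
    "('g, 'm) monoid_scheme \<Rightarrow> ('g \<Rightarrow> ('x \<Rightarrow>\<^sub>L real) \<Rightarrow> ('x \<Rightarrow>\<^sub>L real)) \<Rightarrow>
     ('x::real_normed_vector \<Rightarrow>\<^sub>L real) \<Rightarrow> ('x \<Rightarrow>\<^sub>L real) set" where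
  "orbitope G \<psi> y = (\<lambda>S. convex S \<and> closedin weak_star S) hull (orbit G \<psi> y)"

text \<open>Support functions take values in the extended reals; the supremum over the empty set
  is \<open>-\<infinity>\<close>.\<close>

definition support_primal :: "('x::real_normed_vector \<Rightarrow>\<^sub>L real) \<Rightarrow> 'x set \<Rightarrow> ereal" where
  "support_primal y E = (SUP x\<in>E. ereal (blinfun_apply y x))"

definition support_dual :: "'x::real_normed_vector \<Rightarrow> ('x \<Rightarrow>\<^sub>L real) set \<Rightarrow> ereal" where
  "support_dual x F = (SUP y\<in>F. ereal (blinfun_apply y x))"

definition is_minimizer :: "('a \<Rightarrow> ereal) \<Rightarrow> 'a set \<Rightarrow> 'a \<Rightarrow> bool" where
  "is_minimizer f F y \<longleftrightarrow> y \<in> F \<and> (\<forall>z \<in> F. f y \<le> f z)"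

end

theory Submission
  imports Defs "HOL-Probability.Probability_Measure"
begin

text \<open>
  The orbitope of \<open>yhat\<close> contains an invariant element, and every element of the orbitope
  is again a minimizer.

  The second claim is about convexity. The set of functionals \<open>y\<close> in \<open>F\<close> with
  \<open>H(y|E) \<le> H(yhat|E)\<close> is convex and weak* closed, because \<open>y \<mapsto> H(y|E)\<close> is a supremum of
  evaluations, and it contains the orbit of \<open>yhat\<close>, because \<open>F\<close> and \<open>E\<close> are invariant
  (lemmas \<open>support_primal_sublevel\<close> and \<open>support_primal_dual_action\<close>). Hence it contains the
  orbitope. The bounds on \<open>\<langle>x, ybar\<rangle>\<close> express only that \<open>ybar\<close> lies in the orbitope.

  For the first claim, \<open>orbitope_has_invariant_element\<close>, let
  \<open>\<langle>x, z\<^sub>n\<rangle> = (1/|A\<^sub>n|) \<integral>\<^bsub>A\<^sub>n\<^esub> \<langle>x, g yhat\<rangle> dg\<close> be the averages of the orbit over a Folner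
  sequence. They lie in the orbitope (\<open>weak_star_average_in_closed_convex\<close>), and
  left-invariance of Haar measure gives
  \<open>|\<langle>hx, z\<^sub>n\<rangle> - \<langle>x, z\<^sub>n\<rangle>| \<le> 2C (1 - |A\<^sub>n \<inter> h\<inverse>A\<^sub>n| / |A\<^sub>n|) \<longlonglongrightarrow> 0\<close>, where \<open>C\<close> bounds
  \<open>|\<langle>x, g yhat\<rangle>|\<close> (\<open>haar_average_left_translation\<close>). The orbit is norm bounded, so the
  orbitope is weak* compact by Banach--Alaoglu (\<open>compactin_weak_star_cball\<close>), and an
  accumulation point of the averages is invariant.
\<close>

section \<open>The weak* topology\<close>

lemma closedin_weak_star_evaluation:
  assumes "closed C"
  shows "closedin weak_star {y. blinfun_apply y x \<in> C}"
  using closedin_continuous_map_preimage[OF strong_operator_topology_continuous_evaluation, of C x] assms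
  by (simp add: strong_operator_topology_topspace)

lemma closedin_weak_star_evaluations:
  assumes "\<And>i. i \<in> I \<Longrightarrow> closed (C i)"
  shows "closedin weak_star {y. \<forall>i\<in>I. blinfun_apply y (x i) \<in> C i}"
proof (cases "I = {}")
  case True
  then show ?thesis
    using closedin_topspace[of weak_star] by (simp add: strong_operator_topology_topspace)
next
  case False
  have "{y. \<forall>i\<in>I. blinfun_apply y (x i) \<in> C i} = (\<Inter>i\<in>I. {y. blinfun_apply y (x i) \<in> C i})"
    by auto
  moreover have "closedin weak_star (\<Inter>i\<in>I. {y. blinfun_apply y (x i) \<in> C i})"
    using False assms by (intro closedin_INT closedin_weak_star_evaluation) auto
  ultimately show ?thesis by simp
qed

lemma abs_le_interval_iff: "\<bar>a\<bar> \<le> b \<longleftrightarrow> - b \<le> a \<and> a \<le> b" for a b :: real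
  by auto

lemma norm_blinfun_le_iff:
  fixes y :: "'x::real_normed_vector \<Rightarrow>\<^sub>L real"
  assumes "0 \<le> C"
  shows "norm y \<le> C \<longleftrightarrow> (\<forall>x. \<bar>blinfun_apply y x\<bar> \<le> C * norm x)"
proof
  assume "norm y \<le> C"
  then show "\<forall>x. \<bar>blinfun_apply y x\<bar> \<le> C * norm x"
    by (intro allI order_trans[OF norm_blinfun[of y, unfolded real_norm_def]] mult_right_mono) auto
next
  assume "\<forall>x. \<bar>blinfun_apply y x\<bar> \<le> C * norm x"
  then show "norm y \<le> C"
    by (intro norm_blinfun_bound assms) simp
qed

lemma closedin_weak_star_cball:
  fixes C :: real
  assumes "0 \<le> C"
  shows "closedin weak_star {y :: 'x::real_normed_vector \<Rightarrow>\<^sub>L real. norm y \<le> C}"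
proof -
  have "{y :: 'x \<Rightarrow>\<^sub>L real. norm y \<le> C} = {y. \<forall>x\<in>UNIV. blinfun_apply y x \<in> {- (C * norm x)..C * norm x}}"
    unfolding norm_blinfun_le_iff[OF assms] by (simp add: abs_le_interval_iff)
  moreover have "closedin weak_star \<dots>"
    by (rule closedin_weak_star_evaluations[of UNIV "\<lambda>x. {- (C * norm x)..C * norm x}" "\<lambda>x. x"])
      (rule closed_atLeastAtMost)
  ultimately show ?thesis by (simp only:)
qed

text \<open>Banach--Alaoglu. As functions on the space, the functionals in the ball are a pointwise
  closed subset of a product of compact intervals, to which the Tychonoff theorem applies.\<close>

theorem compactin_weak_star_cball:
  fixes C :: real
  assumes "0 \<le> C"
  shows "compactin weak_star {y :: 'x::real_normed_vector \<Rightarrow>\<^sub>L real. norm y \<le> C}"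
proof -
  define B where "B = {f :: 'x \<Rightarrow> real. linear f \<and> (\<forall>x. \<bar>f x\<bar> \<le> C * norm x)}"
  have ev: "continuous_on UNIV (\<lambda>f :: 'x \<Rightarrow> real. f x)" for x
    by (rule continuous_on_product_coordinates)
  have "compactin (product_topology (\<lambda>_. euclidean) UNIV) (PiE UNIV (\<lambda>x::'x. {- (C * norm x)..C * norm x}))"
    by (subst compactin_PiE) (auto simp: compactin_euclidean_iff)
  then have "compact (PiE UNIV (\<lambda>x::'x. {- (C * norm x)..C * norm x}))"
    by (simp add: euclidean_product_topology)
  moreover have "closed {f :: 'x \<Rightarrow> real. linear f}"
  proof -
    have "{f :: 'x \<Rightarrow> real. linear f} =
      (\<Inter>a. \<Inter>b. {f. f (a + b) = f a + f b}) \<inter> (\<Inter>c. \<Inter>a. {f. f (c *\<^sub>R a) = c *\<^sub>R f a})"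
      by (auto simp: linear_iff)
    then show ?thesis
      by (simp only:) (intro closed_Int closed_INT ballI closed_Collect_eq continuous_intros ev)
  qed
  moreover have "B = PiE UNIV (\<lambda>x. {- (C * norm x)..C * norm x}) \<inter> {f. linear f}"
    unfolding B_def by (auto simp: PiE_def Pi_def abs_le_interval_iff)
  ultimately have B: "compact B"
    by (simp add: compact_Int_closed)
  have bl: "bounded_linear f" if "f \<in> B" for f
    using that unfolding B_def
    by (auto simp: bounded_linear_def bounded_linear_axioms_def intro: exI[of _ C] simp: mult.commute)
  have "continuous_map (top_of_set B) weak_star Blinfun"
    unfolding continuous_on_strong_operator_topo_iff_coordinatewise
  proof
    fix x
    have "continuous_on B (\<lambda>f. blinfun_apply (Blinfun f) x)"
      using continuous_on_subset[OF ev[of x], of B]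
      by (rule continuous_on_eq) (auto simp: bounded_linear_Blinfun_apply bl)
    then show "continuous_map (top_of_set B) euclidean (\<lambda>f. blinfun_apply (Blinfun f) x)"
      by simp
  qed
  then have "compactin weak_star (Blinfun ` B)"
    using B by (intro image_compactin[of "top_of_set B"]) (auto simp: compactin_subtopology)
  moreover have "Blinfun ` B = {y. norm y \<le> C}"
  proof (intro equalityI subsetI)
    fix y assume "y \<in> Blinfun ` B"
    then obtain f where f: "f \<in> B" "y = Blinfun f" by auto
    then show "y \<in> {y. norm y \<le> C}"
      using bl[OF f(1)] unfolding norm_blinfun_le_iff[OF assms] mem_Collect_eq
      by (auto simp: bounded_linear_Blinfun_apply B_def)
  next
    fix y :: "'x \<Rightarrow>\<^sub>L real" assume "y \<in> {y. norm y \<le> C}"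
    then have "blinfun_apply y \<in> B"
      using norm_blinfun_le_iff[OF assms, of y]
      by (auto simp: B_def blinfun.bounded_linear_right bounded_linear.linear)
    then show "y \<in> Blinfun ` B"
      by (metis blinfun_apply_inverse image_eqI)
  qed
  ultimately show ?thesis by simp
qed

lemma weak_star_separating_neighbourhood:
  assumes "closedin weak_star S" "z \<notin> S"
  obtains I e where "finite I" "0 < e"
    "\<And>y. (\<And>x. x \<in> I \<Longrightarrow> \<bar>blinfun_apply y x - blinfun_apply z x\<bar> < e) \<Longrightarrow> y \<notin> S"
proof -
  have "openin weak_star (- S)"
    using assms(1) by (metis Compl_eq_Diff_UNIV closedin_def strong_operator_topology_topspace)
  then obtain U where U: "open U" "- S = blinfun_apply -` U"
    unfolding strong_operator_topology_def openin_pullback_topology by auto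
  from \<open>z \<notin> S\<close> U(2) have "blinfun_apply z \<in> U" by auto
  with product_topology_open_contains_basis[OF U(1)[unfolded open_fun_def]]
  obtain X where X: "blinfun_apply z \<in> PiE UNIV X" "\<And>x. open (X x)"
      "finite {x. X x \<noteq> UNIV}" "PiE UNIV X \<subseteq> U"
    by (metis open_openin topspace_euclidean)
  define I where "I = {x. X x \<noteq> UNIV}"
  have "\<exists>e>0. \<forall>t. \<bar>t - blinfun_apply z x\<bar> < e \<longrightarrow> t \<in> X x" for x
    using X(1) X(2)[of x] unfolding open_dist dist_real_def by blast
  then obtain d where d: "\<And>x. 0 < d x" "\<And>x t. \<bar>t - blinfun_apply z x\<bar> < d x \<Longrightarrow> t \<in> X x"
    by metis
  show ?thesis
  proof
    show "finite I" using X(3) by (simp add: I_def)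
    then show "0 < Min (insert 1 (d ` I))" using d(1) by simp
    fix y assume y: "\<And>x. x \<in> I \<Longrightarrow> \<bar>blinfun_apply y x - blinfun_apply z x\<bar> < Min (insert 1 (d ` I))"
    have "blinfun_apply y x \<in> X x" for x
    proof (cases "x \<in> I")
      case True
      then show ?thesis using y[of x] d(2) \<open>finite I\<close> by auto
    qed (simp add: I_def)
    then have "blinfun_apply y \<in> U" using X(4) by auto
    then show "y \<notin> S" using U(2) by auto
  qed
qed

section \<open>Averages of functionals\<close>

text \<open>Only finitely many evaluations matter for a weak* neighbourhood of the average. Splitting
  the probability space into the finitely many pieces on which these evaluations vary by less
  than \<open>e\<close>, and choosing a sample point in each, gives a Riemann sum of the average which is a
  convex combination of values of \<open>Y\<close>, and hence belongs to \<open>S\<close>.\<close>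

lemma (in prob_space) weak_star_average_in_closed_convex:
  fixes Y :: "'a \<Rightarrow> 'x::real_normed_vector \<Rightarrow>\<^sub>L real"
  assumes meas: "\<And>x. (\<lambda>g. blinfun_apply (Y g) x) \<in> borel_measurable M"
    and bdd: "\<And>g. g \<in> space M \<Longrightarrow> norm (Y g) \<le> C"
    and S: "convex S" "closedin weak_star S" "\<And>g. g \<in> space M \<Longrightarrow> Y g \<in> S"
    and z: "\<And>x. blinfun_apply z x = expectation (\<lambda>g. blinfun_apply (Y g) x)"
  shows "z \<in> S"
proof (rule ccontr)
  assume "z \<notin> S"
  then obtain I e where I: "finite I" and e: "0 < e"
    and sep: "\<And>y. (\<And>x. x \<in> I \<Longrightarrow> \<bar>blinfun_apply y x - blinfun_apply z x\<bar> < e) \<Longrightarrow> y \<notin> S"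
    using weak_star_separating_neighbourhood[OF S(2)] by metis
  define d where "d = e / 2"
  have d: "0 < d" "d < e" using e by (auto simp: d_def)
  have bound: "\<bar>blinfun_apply (Y g) x\<bar> \<le> C * norm x" if "g \<in> space M" for g x
    using norm_blinfun[of "Y g" x] mult_right_mono[OF bdd[OF that] norm_ge_zero[of x]] by simp
  \<comment> \<open>Points with the same cell agree up to \<open>d\<close> under every evaluation in \<open>I\<close>; boundedness
    leaves only finitely many cells.\<close>
  define cell where "cell g = restrict (\<lambda>x. \<lfloor>blinfun_apply (Y g) x / d\<rfloor>) I" for g
  define K where "K = cell ` space M"
  define r where "r k = (SOME g. g \<in> space M \<and> cell g = k)" for k
  have r: "r k \<in> space M" "cell (r k) = k" if "k \<in> K" for k
  proof -
    have "\<exists>g. g \<in> space M \<and> cell g = k" using that by (auto simp: K_def)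
    from someI_ex[OF this] show "r k \<in> space M" "cell (r k) = k" by (auto simp: r_def)
  qed
  have "K \<subseteq> PiE I (\<lambda>x. {\<lfloor>- (C * norm x) / d\<rfloor>..\<lfloor>C * norm x / d\<rfloor>})"
  proof -
    have "\<lfloor>blinfun_apply (Y g) x / d\<rfloor> \<in> {\<lfloor>- (C * norm x) / d\<rfloor>..\<lfloor>C * norm x / d\<rfloor>}"
      if "g \<in> space M" for g x
    proof -
      have "- (C * norm x) \<le> blinfun_apply (Y g) x" "blinfun_apply (Y g) x \<le> C * norm x"
        using bound[OF that, of x] by linarith+
      then have "- (C * norm x) / d \<le> blinfun_apply (Y g) x / d"
          "blinfun_apply (Y g) x / d \<le> C * norm x / d"
        using d(1) divide_right_mono[of _ _ d] by (metis less_imp_le)+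
      then show ?thesis using floor_mono by (metis atLeastAtMost_iff)
    qed
    then show ?thesis unfolding K_def cell_def by fastforce
  qed
  then have finK: "finite K"
    by (rule finite_subset) (use I in \<open>auto intro: finite_PiE\<close>)
  define P where "P k = {g \<in> space M. cell g = k}" for k
  have P[measurable]: "P k \<in> sets M" if "k \<in> K" for k
  proof -
    have "P k = {g \<in> space M. \<forall>x\<in>I. \<lfloor>blinfun_apply (Y g) x / d\<rfloor> = k x}"
      using that by (auto simp: P_def K_def cell_def fun_eq_iff restrict_def)
    also have "\<dots> \<in> sets M"
      using I meas by measurable
    finally show ?thesis .
  qed
  define y where "y = (\<Sum>k\<in>K. prob (P k) *\<^sub>R Y (r k))"
  have step: "(\<Sum>k\<in>K. indicator (P k) g * a k) = a (cell g)" if "g \<in> space M" for g and a :: "_ \<Rightarrow> real"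
  proof -
    have "(\<Sum>k\<in>K. indicator (P k) g * a k) = (\<Sum>k\<in>K. if k = cell g then a k else 0)"
      using that by (intro sum.cong) (auto simp: P_def indicator_def)
    also have "\<dots> = a (cell g)" using finK that by (simp add: K_def)
    finally show ?thesis .
  qed
  have int_step: "expectation (\<lambda>g. a (cell g)) = (\<Sum>k\<in>K. prob (P k) * a k)"
    and integrable_step: "integrable M (\<lambda>g. a (cell g))" for a :: "_ \<Rightarrow> real"
  proof -
    have i: "integrable M (\<lambda>g. indicator (P k) g * a k)" if "k \<in> K" for k
      using P[OF that] by (simp add: emeasure_eq_measure)
    have "expectation (\<lambda>g. a (cell g)) = expectation (\<lambda>g. \<Sum>k\<in>K. indicator (P k) g * a k)"
      by (intro Bochner_Integration.integral_cong refl) (simp add: step)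
    also have "\<dots> = (\<Sum>k\<in>K. prob (P k) * a k)"
      using i P by (subst Bochner_Integration.integral_sum) (auto intro!: sum.cong)
    finally show "expectation (\<lambda>g. a (cell g)) = (\<Sum>k\<in>K. prob (P k) * a k)" .
    have "integrable M (\<lambda>g. \<Sum>k\<in>K. indicator (P k) g * a k)"
      using i by simp
    then show "integrable M (\<lambda>g. a (cell g))"
      by (rule Bochner_Integration.integrable_cong[THEN iffD1, rotated -1]) (simp_all add: step)
  qed
  have "y \<in> S"
    unfolding y_def
  proof (intro convex_sum finK S(1))
    show "(\<Sum>k\<in>K. prob (P k)) = 1" using int_step[of "\<lambda>_. 1"] by (simp add: prob_space)
  qed (use r S(3) in auto)
  moreover have "\<bar>blinfun_apply y x - blinfun_apply z x\<bar> < e" if "x \<in> I" for x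
  proof -
    define a where "a k = blinfun_apply (Y (r k)) x" for k
    have "blinfun_apply y x = (\<Sum>k\<in>K. prob (P k) * a k)"
      unfolding y_def a_def by (simp add: blinfun.sum_left blinfun.scaleR_left)
    also have "\<dots> = expectation (\<lambda>g. a (cell g))" by (simp add: int_step)
    finally have yx: "blinfun_apply y x = expectation (\<lambda>g. a (cell g))" .
    have i: "integrable M (\<lambda>g. blinfun_apply (Y g) x)"
      using meas bound by (intro integrable_const_bound[where B="C * norm x"]) auto
    have near: "\<bar>a (cell g) - blinfun_apply (Y g) x\<bar> \<le> d" if g: "g \<in> space M" for g
    proof -
      have "cell (r (cell g)) = cell g" using r g by (auto simp: K_def)
      then have "cell (r (cell g)) x = cell g x" by simp
      then have "\<lfloor>a (cell g) / d\<rfloor> = \<lfloor>blinfun_apply (Y g) x / d\<rfloor>"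
        using \<open>x \<in> I\<close> by (simp add: cell_def a_def)
      then have "\<bar>a (cell g) / d - blinfun_apply (Y g) x / d\<bar> \<le> 1" by linarith
      then have "\<bar>a (cell g) - blinfun_apply (Y g) x\<bar> / d \<le> 1"
        using d(1) by (simp add: diff_divide_distrib[symmetric] abs_divide)
      then show ?thesis using d(1) by simp
    qed
    have "\<bar>blinfun_apply y x - blinfun_apply z x\<bar> = \<bar>expectation (\<lambda>g. a (cell g) - blinfun_apply (Y g) x)\<bar>"
      unfolding yx z using i integrable_step by simp
    also have "\<dots> \<le> expectation (\<lambda>g. \<bar>a (cell g) - blinfun_apply (Y g) x\<bar>)"
      by (rule integral_abs_bound)
    also have "\<dots> \<le> expectation (\<lambda>g. d)"
      using near i integrable_step by (intro integral_mono) auto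
    finally show ?thesis using d(2) by (simp add: prob_space)
  qed
  ultimately show False using sep by blast
qed

text \<open>The Gelfand integral of a bounded family of functionals: the bound on the norms carries
  over to the integrated evaluations, which therefore form a continuous functional.\<close>

lemma (in prob_space) weak_star_average_exists:
  fixes Y :: "'a \<Rightarrow> 'x::real_normed_vector \<Rightarrow>\<^sub>L real"
  assumes meas: "\<And>x. (\<lambda>g. blinfun_apply (Y g) x) \<in> borel_measurable M"
    and bdd: "\<And>g. g \<in> space M \<Longrightarrow> norm (Y g) \<le> C"
  obtains z where "\<And>x. blinfun_apply z x = expectation (\<lambda>g. blinfun_apply (Y g) x)"
proof -
  have bound: "\<bar>blinfun_apply (Y g) x\<bar> \<le> norm x * C" if "g \<in> space M" for g x
    using norm_blinfun[of "Y g" x] mult_right_mono[OF bdd[OF that] norm_ge_zero[of x]]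
    by (simp add: mult.commute)
  have i: "integrable M (\<lambda>g. blinfun_apply (Y g) x)" for x
    using meas bound by (intro integrable_const_bound[where B="norm x * C"]) auto
  have "bounded_linear (\<lambda>x. expectation (\<lambda>g. blinfun_apply (Y g) x))"
  proof (rule bounded_linear_intro[where K=C])
    fix x
    have "\<bar>expectation (\<lambda>g. blinfun_apply (Y g) x)\<bar> \<le> expectation (\<lambda>g. \<bar>blinfun_apply (Y g) x\<bar>)"
      by (rule integral_abs_bound)
    also have "\<dots> \<le> expectation (\<lambda>g. norm x * C)"
      using bound i by (intro integral_mono) auto
    finally show "norm (expectation (\<lambda>g. blinfun_apply (Y g) x)) \<le> norm x * C"
      by (simp add: prob_space)
  qed (simp_all add: i blinfun.add_right blinfun.scaleR_right)
  then show ?thesis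
    using that[of "Blinfun (\<lambda>x. expectation (\<lambda>g. blinfun_apply (Y g) x))"]
    by (simp add: bounded_linear_Blinfun_apply)
qed

lemma integral_uniform_measure:
  fixes f :: "'a \<Rightarrow> real"
  assumes "A \<in> sets M" "emeasure M A \<noteq> \<infinity>" "emeasure M A \<noteq> 0" "f \<in> borel_measurable M"
  shows "integral\<^sup>L (uniform_measure M A) f = (\<integral>x. indicator A x * f x \<partial>M) / measure M A"
proof -
  have em: "emeasure M A = ennreal (measure M A)"
    using assms(2) by (intro emeasure_eq_ennreal_measure) simp
  then have pos: "0 < measure M A"
    using assms(3) by (metis ennreal_0 measure_nonneg order_le_less)
  have "uniform_measure M A = density M (\<lambda>x. ennreal (indicator A x / measure M A))"
    unfolding uniform_measure_def
    by (intro arg_cong2[where f=density] refl ext)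
      (use divide_ennreal[of 1 "measure M A"] pos in \<open>simp add: em indicator_def\<close>)
  then have "integral\<^sup>L (uniform_measure M A) f = (\<integral>x. indicator A x / measure M A * f x \<partial>M)"
    using assms(1,4) pos by (simp add: integral_real_density)
  also have "\<dots> = (\<integral>x. (indicator A x * f x) / measure M A \<partial>M)"
    by (simp add: field_simps)
  finally show ?thesis by simp
qed

section \<open>Haar measure and Folner averages\<close>

lemma haar_compactin_measurable:
  assumes "haar_measure G T \<mu>" "Hausdorff_space T" "compactin T A"
  shows "A \<in> sets \<mu>"
proof -
  have "closedin T A" using assms(2,3) by (rule compactin_imp_closedin)
  then have "openin T (topspace T - A)" "A \<subseteq> topspace T" by (auto simp: closedin_def)
  then have "topspace T - (topspace T - A) \<in> sigma_sets (topspace T) {U. openin T U}"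
    by (intro sigma_sets.Compl sigma_sets.Basic) auto
  moreover have "topspace T - (topspace T - A) = A" using \<open>A \<subseteq> topspace T\<close> by auto
  ultimately show ?thesis using assms(1) by (simp add: haar_measure_def)
qed

lemma haar_continuous_map_measurable:
  assumes "haar_measure G T \<mu>" "continuous_map T euclidean (f :: 'g \<Rightarrow> 'b::topological_space)"
  shows "f \<in> borel_measurable \<mu>"
proof (rule borel_measurableI)
  fix U :: "'b set" assume "open U"
  then have "openin T {g \<in> topspace T. f g \<in> U}"
    using openin_continuous_map_preimage[OF assms(2)] by simp
  moreover have "f -` U \<inter> space \<mu> = {g \<in> topspace T. f g \<in> U}"
    using assms(1) by (auto simp: haar_measure_def)
  ultimately show "f -` U \<inter> space \<mu> \<in> sets \<mu>"
    using assms(1) by (simp add: haar_measure_def sigma_sets.Basic)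
qed

lemma continuous_map_left_translation:
  assumes "topological_group G T" "h \<in> carrier G"
  shows "continuous_map T T (\<lambda>g. h \<otimes>\<^bsub>G\<^esub> g)"
proof -
  have "continuous_map T (prod_topology T T) (\<lambda>g. (h, g))"
    using assms by (intro continuous_map_pairedI) (auto simp: topological_group_def)
  then have "continuous_map T T ((\<lambda>(g, h). g \<otimes>\<^bsub>G\<^esub> h) \<circ> (\<lambda>g. (h, g)))"
    using assms(1) by (auto simp: topological_group_def intro: continuous_map_compose)
  then show ?thesis by (simp add: comp_def)
qed

lemma vimage_left_translation:
  assumes "group G" "h \<in> carrier G" "B \<subseteq> carrier G"
  shows "(\<lambda>g. h \<otimes>\<^bsub>G\<^esub> g) -` B \<inter> carrier G = (inv\<^bsub>G\<^esub> h) <#\<^bsub>G\<^esub> B"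
proof -
  interpret group G by fact
  show ?thesis
  proof (intro equalityI subsetI)
    fix g assume "g \<in> (\<lambda>g. h \<otimes>\<^bsub>G\<^esub> g) -` B \<inter> carrier G"
    then have "h \<otimes>\<^bsub>G\<^esub> g \<in> B" "g = inv\<^bsub>G\<^esub> h \<otimes>\<^bsub>G\<^esub> (h \<otimes>\<^bsub>G\<^esub> g)"
      using assms(2) by (auto simp: m_assoc[symmetric])
    then show "g \<in> (inv\<^bsub>G\<^esub> h) <#\<^bsub>G\<^esub> B" unfolding l_coset_def by blast
  next
    fix g assume "g \<in> (inv\<^bsub>G\<^esub> h) <#\<^bsub>G\<^esub> B"
    then obtain b where "b \<in> B" "g = inv\<^bsub>G\<^esub> h \<otimes>\<^bsub>G\<^esub> b" unfolding l_coset_def by blast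
    then show "g \<in> (\<lambda>g. h \<otimes>\<^bsub>G\<^esub> g) -` B \<inter> carrier G"
      using assms(2,3) by (auto simp: m_assoc[symmetric])
  qed
qed

lemma left_translation_measurable:
  assumes "topological_group G T" "haar_measure G T \<mu>" "h \<in> carrier G"
  shows "(\<lambda>g. h \<otimes>\<^bsub>G\<^esub> g) \<in> measurable \<mu> \<mu>"
proof (rule measurable_sigma_sets)
  show "sets \<mu> = sigma_sets (topspace T) {U. openin T U}"
    using assms(2) by (simp add: haar_measure_def)
  show "{U. openin T U} \<subseteq> Pow (topspace T)"
    using openin_subset by blast
  have sp: "space \<mu> = topspace T" using assms(2) by (simp add: haar_measure_def)
  show "(\<lambda>g. h \<otimes>\<^bsub>G\<^esub> g) \<in> space \<mu> \<rightarrow> topspace T"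
    using continuous_map_left_translation[OF assms(1,3)] by (simp add: sp continuous_map_def)
  fix U assume "U \<in> {U. openin T U}"
  then have "openin T {g \<in> topspace T. h \<otimes>\<^bsub>G\<^esub> g \<in> U}"
    using openin_continuous_map_preimage[OF continuous_map_left_translation[OF assms(1,3)]] by simp
  moreover have "(\<lambda>g. h \<otimes>\<^bsub>G\<^esub> g) -` U \<inter> space \<mu> = {g \<in> topspace T. h \<otimes>\<^bsub>G\<^esub> g \<in> U}"
    by (auto simp: sp)
  ultimately show "(\<lambda>g. h \<otimes>\<^bsub>G\<^esub> g) -` U \<inter> space \<mu> \<in> sets \<mu>"
    using assms(2) by (simp add: haar_measure_def sigma_sets.Basic)
qed

lemma distr_left_translation:
  assumes "topological_group G T" "haar_measure G T \<mu>" "h \<in> carrier G"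
  shows "distr \<mu> \<mu> (\<lambda>g. h \<otimes>\<^bsub>G\<^esub> g) = \<mu>"
proof (rule measure_eqI)
  fix B assume "B \<in> sets (distr \<mu> \<mu> (\<lambda>g. h \<otimes>\<^bsub>G\<^esub> g))"
  then have B: "B \<in> sets \<mu>" by simp
  have G: "group G" "space \<mu> = carrier G"
    using assms by (auto simp: topological_group_def haar_measure_def)
  have "emeasure (distr \<mu> \<mu> (\<lambda>g. h \<otimes>\<^bsub>G\<^esub> g)) B = emeasure \<mu> ((inv\<^bsub>G\<^esub> h) <#\<^bsub>G\<^esub> B)"
    using B sets.sets_into_space[OF B]
    by (simp add: emeasure_distr left_translation_measurable[OF assms] G(2) vimage_left_translation[OF G(1) assms(3)])
  also have "\<dots> = emeasure \<mu> B"
    using assms B by (simp add: haar_measure_def group.inv_closed[OF G(1)])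
  finally show "emeasure (distr \<mu> \<mu> (\<lambda>g. h \<otimes>\<^bsub>G\<^esub> g)) B = emeasure \<mu> B" .
qed simp

text \<open>Translating \<open>f\<close> moves its average over \<open>A\<close> to the average over \<open>hA\<close>, which has
  the same measure. The two integrals differ only on the symmetric difference of \<open>A\<close> and
  \<open>hA\<close>, whose measure is \<open>2 (|A| - |A \<inter> hA|)\<close>; for Folner sets this is negligible against
  \<open>|A|\<close>.\<close>

lemma haar_average_left_translation:
  fixes f :: "'g \<Rightarrow> real"
  assumes "topological_group G T" "haar_measure G T \<mu>" "h \<in> carrier G"
    and A: "A \<in> sets \<mu>" "emeasure \<mu> A \<noteq> \<infinity>" "emeasure \<mu> A \<noteq> 0"
    and f: "f \<in> borel_measurable \<mu>" "\<And>g. g \<in> carrier G \<Longrightarrow> \<bar>f g\<bar> \<le> C"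
  shows "\<bar>(\<integral>g. f (h \<otimes>\<^bsub>G\<^esub> g) \<partial>uniform_measure \<mu> A) - (\<integral>g. f g \<partial>uniform_measure \<mu> A)\<bar>
    \<le> 2 * C * (1 - measure \<mu> (A \<inter> (h <#\<^bsub>G\<^esub> A)) / measure \<mu> A)"
proof -
  have G: "group G" "space \<mu> = carrier G"
    using assms(1,2) by (auto simp: topological_group_def haar_measure_def)
  interpret group G by fact
  note tm[measurable] = left_translation_measurable[OF assms(1,2,3)]
  note [measurable] = A(1) f(1)
  have AG: "A \<subseteq> carrier G" using sets.sets_into_space[OF A(1)] G(2) by simp
  define hA where "hA = h <#\<^bsub>G\<^esub> A"
  have "hA = (\<lambda>g. inv\<^bsub>G\<^esub> h \<otimes>\<^bsub>G\<^esub> g) -` A \<inter> space \<mu>"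
    using vimage_left_translation[OF G(1) inv_closed[OF assms(3)] AG] assms(3) G(2) by (simp add: hA_def)
  then have hA[measurable]: "hA \<in> sets \<mu>"
    using measurable_sets[OF left_translation_measurable[OF assms(1,2) inv_closed[OF assms(3)]] A(1)] by simp
  have em: "emeasure \<mu> hA = emeasure \<mu> A"
    using assms(2,3) A(1) by (simp add: haar_measure_def hA_def)
  have m: "measure \<mu> hA = measure \<mu> A" by (simp add: measure_def em)
  have pos: "0 < measure \<mu> A"
    using A(2,3) by (metis emeasure_eq_ennreal_measure ennreal_0 infinity_ennreal_def measure_nonneg order_le_less)
  have fin: "emeasure \<mu> A < \<infinity>" "emeasure \<mu> hA < \<infinity>" "emeasure \<mu> (A \<inter> hA) < \<infinity>"
    using A(2) em emeasure_mono[OF Int_lower1 A(1), of hA]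
    by (metis infinity_ennreal_def le_less_trans less_top)+
  \<comment> \<open>Writing the weight as a function of \<open>hg\<close> makes the integrand of the translated average
    a function of \<open>hg\<close>, so that left-invariance applies to it as a whole.\<close>
  have mem: "indicator A g = (indicator hA (h \<otimes>\<^bsub>G\<^esub> g) :: real)" if "g \<in> carrier G" for g
  proof -
    have "h \<otimes>\<^bsub>G\<^esub> g \<in> hA \<longleftrightarrow> g \<in> A"
      using that assms(3) AG Units_l_cancel[of h] unfolding hA_def l_coset_def
      by (auto simp: subset_iff)
    then show ?thesis by (simp add: indicator_def)
  qed
  have ind: "integrable \<mu> (indicator A :: _ \<Rightarrow> real)" "integrable \<mu> (indicator hA :: _ \<Rightarrow> real)"
      "integrable \<mu> (indicator (A \<inter> hA) :: _ \<Rightarrow> real)"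
    using fin by auto
  have i: "integrable \<mu> (\<lambda>g. indicator B g * f g)" if "B \<in> {A, hA}" for B
  proof (rule Bochner_Integration.integrable_bound[where f="\<lambda>g. indicator B g * C"])
    show "integrable \<mu> (\<lambda>g. indicator B g * C)" using that ind by auto
    show "(\<lambda>g. indicator B g * f g) \<in> borel_measurable \<mu>" using that by auto
    show "AE g in \<mu>. norm (indicator B g * f g) \<le> norm (indicator B g * C)"
    proof (rule AE_I2)
      fix g assume "g \<in> space \<mu>"
      then show "norm (indicator B g * f g) \<le> norm (indicator B g * C)"
        using f(2)[of g] G(2) by (simp add: indicator_def)
    qed
  qed
  have "(\<integral>g. indicator A g * f (h \<otimes>\<^bsub>G\<^esub> g) \<partial>\<mu>) = (\<integral>g. indicator hA (h \<otimes>\<^bsub>G\<^esub> g) * f (h \<otimes>\<^bsub>G\<^esub> g) \<partial>\<mu>)"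
    by (intro Bochner_Integration.integral_cong refl) (simp add: mem G(2))
  also have "\<dots> = (\<integral>g. indicator hA g * f g \<partial>distr \<mu> \<mu> (\<lambda>g. h \<otimes>\<^bsub>G\<^esub> g))"
    by (rule integral_distr[symmetric]) auto
  finally have shift: "(\<integral>g. indicator A g * f (h \<otimes>\<^bsub>G\<^esub> g) \<partial>\<mu>) = (\<integral>g. indicator hA g * f g \<partial>\<mu>)"
    by (simp only: distr_left_translation[OF assms(1,2,3)])
  have "\<bar>(\<integral>g. indicator hA g * f g \<partial>\<mu>) - (\<integral>g. indicator A g * f g \<partial>\<mu>)\<bar>
      = \<bar>\<integral>g. indicator hA g * f g - indicator A g * f g \<partial>\<mu>\<bar>"
    using i by simp
  also have "\<dots> \<le> (\<integral>g. \<bar>indicator hA g * f g - indicator A g * f g\<bar> \<partial>\<mu>)"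
    by (rule integral_abs_bound)
  also have "\<dots> \<le> (\<integral>g. C * (indicator hA g + indicator A g - 2 * indicator (A \<inter> hA) g) \<partial>\<mu>)"
  proof (rule integral_mono)
    show "integrable \<mu> (\<lambda>g. \<bar>indicator hA g * f g - indicator A g * f g\<bar>)" using i by auto
    show "integrable \<mu> (\<lambda>g. C * (indicator hA g + indicator A g - 2 * indicator (A \<inter> hA) g))"
      using ind by (intro integrable_mult_right Bochner_Integration.integrable_diff Bochner_Integration.integrable_add) auto
    fix g assume "g \<in> space \<mu>"
    then have "\<bar>f g\<bar> \<le> C" using f(2) G(2) by simp
    then show "\<bar>indicator hA g * f g - indicator A g * f g\<bar>
        \<le> C * (indicator hA g + indicator A g - 2 * indicator (A \<inter> hA) g)"
      by (auto simp: indicator_def)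
  qed
  also have "\<dots> = C * (measure \<mu> hA + measure \<mu> A - 2 * measure \<mu> (A \<inter> hA))"
    using ind sets.sets_into_space[OF hA] sets.sets_into_space[OF A(1)]
    by (simp add: Int_absorb1 Int_absorb2 Int_assoc)
  finally have est: "\<bar>(\<integral>g. indicator hA g * f g \<partial>\<mu>) - (\<integral>g. indicator A g * f g \<partial>\<mu>)\<bar>
      \<le> 2 * C * (measure \<mu> A - measure \<mu> (A \<inter> hA))"
    by (simp add: m algebra_simps)
  have "(\<integral>g. f (h \<otimes>\<^bsub>G\<^esub> g) \<partial>uniform_measure \<mu> A) - (\<integral>g. f g \<partial>uniform_measure \<mu> A)
      = ((\<integral>g. indicator hA g * f g \<partial>\<mu>) - (\<integral>g. indicator A g * f g \<partial>\<mu>)) / measure \<mu> A"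
    using A by (simp add: integral_uniform_measure shift diff_divide_distrib)
  also have "\<bar>\<dots>\<bar> \<le> 2 * C * (measure \<mu> A - measure \<mu> (A \<inter> hA)) / measure \<mu> A"
    using est pos by (simp add: abs_divide divide_right_mono)
  also have "\<dots> = 2 * C * (1 - measure \<mu> (A \<inter> hA) / measure \<mu> A)"
    using pos by (simp add: field_simps)
  finally show ?thesis by (simp only: hA_def)
qed

section \<open>Invariant elements of orbitopes\<close>

lemma dual_action_apply:
  assumes "acts_dually G T \<phi> \<psi>" "g \<in> carrier G"
  shows "blinfun_apply (\<psi> g y) x = blinfun_apply y (\<phi> (inv\<^bsub>G\<^esub> g) x)"
proof -
  have act: "group_action G UNIV \<phi>"
    using assms(1) by (simp add: acts_dually_def linear_continuous_action_def)
  then interpret group G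
    by (simp add: group_action_def group_hom_def)
  have "\<phi> (inv\<^bsub>G\<^esub> (inv\<^bsub>G\<^esub> g)) (\<phi> (inv\<^bsub>G\<^esub> g) x) = x"
    by (rule group_action.orbit_sym_aux[OF act]) (use assms(2) in auto)
  then have "\<phi> g (\<phi> (inv\<^bsub>G\<^esub> g) x) = x" using assms(2) by simp
  then show ?thesis using assms unfolding acts_dually_def by metis
qed

text \<open>Moving the group element to the other side of the pairing turns the orbit of a functional
  into the orbit of a vector, to which the continuity of the action applies.\<close>

lemma continuous_map_dual_orbit:
  assumes "topological_group G T" "acts_dually G T \<phi> \<psi>"
  shows "continuous_map T euclidean (\<lambda>g. blinfun_apply (\<psi> g y) x)"
proof -
  have "continuous_map T (prod_topology T euclidean) (\<lambda>g. (inv\<^bsub>G\<^esub> g, x))"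
    using assms(1) by (intro continuous_map_pairedI) (auto simp: topological_group_def)
  moreover have "continuous_map (prod_topology T euclidean) euclidean (\<lambda>(g, x). \<phi> g x)"
    using assms(2) by (simp add: acts_dually_def linear_continuous_action_def)
  ultimately have "continuous_map T euclidean ((\<lambda>(g, x). \<phi> g x) \<circ> (\<lambda>g. (inv\<^bsub>G\<^esub> g, x)))"
    by (rule continuous_map_compose)
  moreover have "continuous_map euclidean euclidean (blinfun_apply y)"
    by (simp add: linear_continuous_on blinfun.bounded_linear_right)
  ultimately have "continuous_map T euclidean (blinfun_apply y \<circ> ((\<lambda>(g, x). \<phi> g x) \<circ> (\<lambda>g. (inv\<^bsub>G\<^esub> g, x))))"
    by (rule continuous_map_compose)
  then show ?thesis
    using assms dual_action_apply[OF assms(2)]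
    by (elim continuous_map_eq) (simp add: topological_group_def)
qed

lemma orbitope_least:
  assumes "orbit G \<psi> y \<subseteq> S" "convex S" "closedin weak_star S"
  shows "orbitope G \<psi> y \<subseteq> S"
  unfolding orbitope_def using assms by (intro hull_minimal) auto

lemma orbit_subset_orbitope: "orbit G \<psi> y \<subseteq> orbitope G \<psi> y"
  unfolding orbitope_def by (rule hull_subset)

lemma convex_closedin_orbitope:
  "convex (orbitope G \<psi> y) \<and> closedin weak_star (orbitope G \<psi> y)"
  unfolding orbitope_def
proof (rule hull_in)
  fix \<S> :: "('a \<Rightarrow>\<^sub>L real) set set"
  assume *: "\<forall>S\<in>\<S>. convex S \<and> closedin weak_star S"
  have "closedin weak_star (\<Inter>\<S>)"
  proof (cases "\<S> = {}")
    case True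
    then show ?thesis using closedin_topspace[of weak_star] by (simp add: strong_operator_topology_topspace)
  qed (use * in auto)
  then show "convex (\<Inter>\<S>) \<and> closedin weak_star (\<Inter>\<S>)"
    using * by (auto intro: convex_Inter)
qed

text \<open>The averages of an orbit over Folner sets lie in the orbitope and are nearly invariant.
  Invariance under \<open>h\<close>, tested at \<open>x\<close> up to \<open>e\<close>, cuts out a weak* closed set; late averages
  belong to any finitely many of these sets, so by compactness of the orbitope some point
  belongs to all of them.\<close>

theorem orbitope_has_invariant_element:
  fixes \<psi> :: "'g \<Rightarrow> ('x::real_normed_vector \<Rightarrow>\<^sub>L real) \<Rightarrow> ('x \<Rightarrow>\<^sub>L real)"
  assumes G: "nice_amenable_group G T" and dual: "acts_dually G T \<phi> \<psi>"
    and bdd: "bounded (orbit G \<psi> y)"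
  obtains z where "z \<in> orbitope G \<psi> y" "invariant_element G \<psi> z"
proof -
  obtain \<mu> A where tg: "topological_group G T" and Haus: "Hausdorff_space T"
    and haar: "haar_measure G T \<mu>" and folner: "folner_sequence G T \<mu> A"
    using G unfolding nice_amenable_group_def nice_group_def polish_topology_def
    by (auto dest: completely_metrizable_imp_metrizable_space metrizable_imp_Hausdorff_space)
  interpret group G using tg by (simp add: topological_group_def)
  have sp: "space \<mu> = carrier G" using tg haar by (simp add: topological_group_def haar_measure_def)
  obtain C where C: "0 \<le> C" "\<And>g. g \<in> carrier G \<Longrightarrow> norm (\<psi> g y) \<le> C"
  proof -
    obtain b where "0 < b" "\<forall>v\<in>orbit G \<psi> y. norm v \<le> b"
      using bdd unfolding bounded_pos by blast
    then show ?thesis by (intro that[of b]) (auto simp: orbit_def)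
  qed
  have A: "A n \<in> sets \<mu>" "emeasure \<mu> (A n) \<noteq> \<infinity>" for n
    using folner haar haar_compactin_measurable[OF haar Haus]
    by (auto simp: folner_sequence_def haar_measure_def less_top)
  have ratio: "(\<lambda>n. measure \<mu> (A n \<inter> (h <#\<^bsub>G\<^esub> A n)) / measure \<mu> (A n)) \<longlonglongrightarrow> 1"
    if h: "h \<in> carrier G" for h
  proof -
    have "compactin T {h}" using h tg by (simp add: topological_group_def)
    then show ?thesis
      using folner unfolding folner_sequence_def by (auto simp: l_coset_eq_set_mult)
  qed
  \<comment> \<open>A quotient by \<open>|A n| = 0\<close> is \<open>0\<close>, whereas the quotients tend to \<open>1\<close>.\<close>
  have "\<forall>\<^sub>F n in sequentially. measure \<mu> (A n \<inter> (\<one>\<^bsub>G\<^esub> <#\<^bsub>G\<^esub> A n)) / measure \<mu> (A n) > 0"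
    using order_tendstoD(1)[OF ratio[OF one_closed], of 0] by simp
  then have nonnull: "\<forall>\<^sub>F n in sequentially. emeasure \<mu> (A n) \<noteq> 0"
    by (rule eventually_mono) (auto simp: measure_def)
  have meas: "(\<lambda>g. blinfun_apply (\<psi> g y) x) \<in> borel_measurable \<mu>" for x
    by (rule haar_continuous_map_measurable[OF haar continuous_map_dual_orbit[OF tg dual]])
  define avg where "avg n x = (\<integral>g. blinfun_apply (\<psi> g y) x \<partial>uniform_measure \<mu> (A n))" for n x
  have "\<exists>z. emeasure \<mu> (A n) \<noteq> 0 \<longrightarrow>
      z \<in> orbitope G \<psi> y \<and> (\<forall>x. blinfun_apply z x = avg n x)" for n
  proof (cases "emeasure \<mu> (A n) = 0")
    case False
    interpret U: prob_space "uniform_measure \<mu> (A n)"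
      using A[of n] False by (intro prob_space_uniform_measure) auto
    have m: "(\<lambda>g. blinfun_apply (\<psi> g y) x) \<in> borel_measurable (uniform_measure \<mu> (A n))" for x
      using meas by simp
    have b: "norm (\<psi> g y) \<le> C" if "g \<in> space (uniform_measure \<mu> (A n))" for g
      using that C(2) by (simp add: sp)
    obtain z where z: "\<And>x. blinfun_apply z x = avg n x"
      unfolding avg_def using U.weak_star_average_exists[OF m b] by metis
    have "z \<in> orbitope G \<psi> y"
    proof (rule U.weak_star_average_in_closed_convex[OF m b])
      show "\<psi> g y \<in> orbitope G \<psi> y" if "g \<in> space (uniform_measure \<mu> (A n))" for g
        using that orbit_subset_orbitope[of G \<psi> y] by (auto simp: sp orbit_def)
    qed (use convex_closedin_orbitope[of G \<psi> y] z in \<open>auto simp: avg_def\<close>)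
    then show ?thesis using z by blast
  qed auto
  \<comment> \<open>Averaging is possible only over sets of positive measure, which \<open>A n\<close> has for large \<open>n\<close>;
    the other values of \<open>Z\<close> are arbitrary.\<close>
  then obtain Z where Z: "\<And>n. emeasure \<mu> (A n) \<noteq> 0 \<Longrightarrow> Z n \<in> orbitope G \<psi> y"
      "\<And>n x. emeasure \<mu> (A n) \<noteq> 0 \<Longrightarrow> blinfun_apply (Z n) x = avg n x"
    by metis
  define almost where "almost p = {w :: 'x \<Rightarrow>\<^sub>L real. case p of (h, x, e) \<Rightarrow>
      \<bar>blinfun_apply w (\<phi> h x - x)\<bar> \<le> e}" for p :: "'g \<times> 'x \<times> real"
  define test where "test = {(h, x :: 'x, e) | h x e. h \<in> carrier G \<and> (0::real) < e}"
  have closed: "closedin weak_star (almost p)" for p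
  proof -
    obtain h x e where p: "p = (h, x, e)" by (cases p) auto
    have "almost p = {w. blinfun_apply w (\<phi> h x - x) \<in> {- e..e}}"
      by (auto simp: almost_def p)
    then show ?thesis using closedin_weak_star_evaluation[of "{- e..e}"] by simp
  qed
  have late: "\<forall>\<^sub>F n in sequentially. Z n \<in> almost p" if "p \<in> test" for p
  proof -
    obtain h x e where p: "p = (h, x, e)" and h: "h \<in> carrier G" and e: "0 < e"
      using \<open>p \<in> test\<close> by (auto simp: test_def)
    \<comment> \<open>Testing an average at \<open>hx\<close> instead of \<open>x\<close> translates the integrand by \<open>h\<inverse>\<close>.\<close>
    define k where "k = inv\<^bsub>G\<^esub> h"
    have k: "k \<in> carrier G" using h by (simp add: k_def)
    have shift: "blinfun_apply (\<psi> g y) (\<phi> h x) = blinfun_apply (\<psi> (k \<otimes>\<^bsub>G\<^esub> g) y) x"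
      if g: "g \<in> carrier G" for g
    proof -
      have act: "group_action G UNIV \<phi>"
        using dual by (simp add: acts_dually_def linear_continuous_action_def)
      have "\<phi> (inv\<^bsub>G\<^esub> (k \<otimes>\<^bsub>G\<^esub> g)) x = \<phi> (inv\<^bsub>G\<^esub> g) (\<phi> h x)"
        using g h by (simp add: k_def inv_mult_group group_action.composition_rule[OF act])
      then show ?thesis
        using g k by (simp add: dual_action_apply[OF dual])
    qed
    define B where "B = 2 * (C * norm x)"
    have bnd: "\<bar>blinfun_apply (\<psi> g y) x\<bar> \<le> C * norm x" if "g \<in> carrier G" for g
      using norm_blinfun_le_iff[OF C(1)] C(2)[OF that] by blast
    have "(\<lambda>n. B * (1 - measure \<mu> (A n \<inter> (k <#\<^bsub>G\<^esub> A n)) / measure \<mu> (A n))) \<longlonglongrightarrow> B * (1 - 1)"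
      by (intro tendsto_intros ratio k)
    then have "\<forall>\<^sub>F n in sequentially. B * (1 - measure \<mu> (A n \<inter> (k <#\<^bsub>G\<^esub> A n)) / measure \<mu> (A n)) < e"
      using e by (intro order_tendstoD(2)) auto
    then show ?thesis
      using nonnull
    proof eventually_elim
      case (elim n)
      have "avg n (\<phi> h x) = (\<integral>g. blinfun_apply (\<psi> (k \<otimes>\<^bsub>G\<^esub> g) y) x \<partial>uniform_measure \<mu> (A n))"
        unfolding avg_def by (intro Bochner_Integration.integral_cong refl) (simp add: sp shift)
      then have "\<bar>avg n (\<phi> h x) - avg n x\<bar>
          \<le> B * (1 - measure \<mu> (A n \<inter> (k <#\<^bsub>G\<^esub> A n)) / measure \<mu> (A n))"
        using haar_average_left_translation[OF tg haar k A elim(2) meas bnd]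
        by (simp add: B_def avg_def)
      then have "\<bar>blinfun_apply (Z n) (\<phi> h x - x)\<bar> \<le> e"
        using elim Z(2)[of n] by (simp add: blinfun.diff_right)
      then show ?case by (simp add: almost_def p)
    qed
  qed
  have compact: "compactin weak_star (orbitope G \<psi> y)"
  proof (rule closed_compactin[OF compactin_weak_star_cball[OF C(1)]])
    have "convex {y :: 'x \<Rightarrow>\<^sub>L real. norm y \<le> C}"
      using convex_cball[of "0 :: 'x \<Rightarrow>\<^sub>L real" C] by (simp add: cball_def)
    then show "orbitope G \<psi> y \<subseteq> {y. norm y \<le> C}"
      using C by (intro orbitope_least closedin_weak_star_cball) (auto simp: orbit_def)
  qed (simp add: convex_closedin_orbitope)
  have "orbitope G \<psi> y \<inter> \<Inter>(almost ` test) \<noteq> {}"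
  proof (rule compact[unfolded compactin_fip, THEN conjunct2, rule_format], intro conjI ballI allI impI)
    fix \<F> assume \<F>: "finite \<F> \<and> \<F> \<subseteq> almost ` test"
    then have "\<forall>\<^sub>F n in sequentially. (\<forall>D\<in>\<F>. Z n \<in> D) \<and> emeasure \<mu> (A n) \<noteq> 0"
      using late nonnull by (intro eventually_conj) (auto simp: eventually_ball_finite_distrib)
    then obtain n where "\<forall>D\<in>\<F>. Z n \<in> D" "emeasure \<mu> (A n) \<noteq> 0"
      using eventually_happens sequentially_bot by blast
    then show "orbitope G \<psi> y \<inter> \<Inter>\<F> \<noteq> {}" using Z(1) by blast
  qed (use closed in auto)
  then obtain z where z: "z \<in> orbitope G \<psi> y" "\<And>p. p \<in> test \<Longrightarrow> z \<in> almost p" by blast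
  have fixed: "blinfun_apply z (\<phi> h x) = blinfun_apply z x" if "h \<in> carrier G" for h x
  proof -
    have "\<bar>blinfun_apply z (\<phi> h x - x)\<bar> \<le> 0 + e" if "0 < e" for e
      using z(2)[of "(h, x, e)"] \<open>h \<in> carrier G\<close> that by (simp add: test_def almost_def)
    then have "\<bar>blinfun_apply z (\<phi> h x - x)\<bar> \<le> 0" by (rule field_le_epsilon)
    then show ?thesis by (simp add: blinfun.diff_right)
  qed
  have "invariant_element G \<psi> z"
    unfolding invariant_element_def
    by (auto intro!: blinfun_eqI simp: dual_action_apply[OF dual] fixed)
  then show ?thesis using that z(1) by blast
qed

section \<open>Support functions and minimizers\<close>

text \<open>The support function is a supremum of evaluations, so that its sublevel sets are
  intersections of half-spaces.\<close>

lemma support_primal_sublevel: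
  "convex {y :: 'x::real_normed_vector \<Rightarrow>\<^sub>L real. support_primal y E \<le> c} \<and>
   closedin weak_star {y :: 'x \<Rightarrow>\<^sub>L real. support_primal y E \<le> c}"
proof -
  define R where "R = {r. ereal r \<le> c}"
  have R: "closed R" "convex R"
    by (cases c; auto simp: R_def atMost_def[symmetric] convex_real_interval)+
  have eq: "{y :: 'x \<Rightarrow>\<^sub>L real. support_primal y E \<le> c} = {y. \<forall>x\<in>E. blinfun_apply y x \<in> R}"
    by (auto simp: support_primal_def SUP_le_iff R_def)
  have "closedin weak_star {y :: 'x \<Rightarrow>\<^sub>L real. \<forall>x\<in>E. blinfun_apply y x \<in> R}"
    using R(1) by (rule closedin_weak_star_evaluations[of E "\<lambda>_. R" "\<lambda>x. x"])
  moreover have "convex {y :: 'x \<Rightarrow>\<^sub>L real. \<forall>x\<in>E. blinfun_apply y x \<in> R}"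
    using R(2) by (auto simp: convex_def blinfun.add_left blinfun.scaleR_left)
  ultimately show ?thesis by (simp add: eq)
qed

lemma support_primal_dual_action:
  assumes "acts_dually G T \<phi> \<psi>" "invariant_set G \<phi> E" "g \<in> carrier G"
  shows "support_primal (\<psi> g y) E = support_primal y E"
proof -
  have "group G"
    using assms(1) by (simp add: acts_dually_def group_action_def group_hom_def)
  then have E: "\<phi> (inv\<^bsub>G\<^esub> g) ` E = E"
    using assms(2,3) by (simp add: invariant_set_def)
  have "support_primal (\<psi> g y) E = (SUP x\<in>E. ereal (blinfun_apply y (\<phi> (inv\<^bsub>G\<^esub> g) x)))"
    by (simp add: support_primal_def dual_action_apply[OF assms(1,3)])
  also have "\<dots> = (SUP x\<in>\<phi> (inv\<^bsub>G\<^esub> g) ` E. ereal (blinfun_apply y x))"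
    by (simp add: image_image)
  finally show ?thesis by (simp add: E support_primal_def)
qed

theorem proposition8:
  fixes G :: "('g, 'm) monoid_scheme" and T :: "'g topology"
    and \<phi> :: "'g \<Rightarrow> 'x \<Rightarrow> 'x::real_normed_vector"
    and \<psi> :: "'g \<Rightarrow> ('x \<Rightarrow>\<^sub>L real) \<Rightarrow> ('x \<Rightarrow>\<^sub>L real)"
    and E :: "'x set" and F :: "('x \<Rightarrow>\<^sub>L real) set" and yhat :: "'x \<Rightarrow>\<^sub>L real"
  assumes "nice_amenable_group G T"
    and "acts_dually G T \<phi> \<psi>"
    and "bounded_orbits G \<phi>" and "bounded_orbits G \<psi>"
    and "invariant_set G \<phi> E"
    and "closedin weak_star F" and "convex F" and "invariant_set G \<psi> F"
    and "is_minimizer (\<lambda>y. support_primal y E) F yhat"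
  shows "\<exists>ybar \<in> orbitope G \<psi> yhat.
           is_minimizer (\<lambda>y. support_primal y E) F ybar \<and>
           invariant_element G \<psi> ybar \<and>
           (\<forall>x \<in> E. - support_dual (- x) (orbitope G \<psi> yhat) \<le> ereal (blinfun_apply ybar x) \<and>
                    ereal (blinfun_apply ybar x) \<le> support_dual x (orbitope G \<psi> yhat))"
proof -
  obtain ybar where ybar: "ybar \<in> orbitope G \<psi> yhat" "invariant_element G \<psi> ybar"
    using orbitope_has_invariant_element assms(1,2,4) unfolding bounded_orbits_def by metis
  have yhat: "yhat \<in> F" "\<And>z. z \<in> F \<Longrightarrow> support_primal yhat E \<le> support_primal z E"
    using assms(9) by (auto simp: is_minimizer_def)
  have "orbit G \<psi> yhat \<subseteq> F"
    using yhat(1) assms(8) by (auto simp: orbit_def invariant_set_def)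
  then have "ybar \<in> F"
    using orbitope_least assms(6,7) ybar(1) by blast
  have "orbit G \<psi> yhat \<subseteq> {y. support_primal y E \<le> support_primal yhat E}"
    using support_primal_dual_action[OF assms(2,5)] by (auto simp: orbit_def)
  then have "orbitope G \<psi> yhat \<subseteq> {y. support_primal y E \<le> support_primal yhat E}"
    using support_primal_sublevel by (intro orbitope_least) blast+
  then have "support_primal ybar E \<le> support_primal yhat E" using ybar(1) by blast
  then have "is_minimizer (\<lambda>y. support_primal y E) F ybar"
    using \<open>ybar \<in> F\<close> yhat(2) order_trans unfolding is_minimizer_def by blast
  moreover have upper: "ereal (blinfun_apply ybar x) \<le> support_dual x (orbitope G \<psi> yhat)" for x
    unfolding support_dual_def by (rule SUP_upper[OF ybar(1)])
  moreover have "- support_dual (- x) (orbitope G \<psi> yhat) \<le> ereal (blinfun_apply ybar x)" for x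
    using upper[of "- x"] by (simp add: blinfun.minus_right ereal_uminus_le_reorder)
  ultimately show ?thesis using ybar by blast
qed

end
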